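(* Let $A$ be a commutative associative unital $\mathbb{K}$-algebra over a field $\mathbb{K}$ and let $n\ge 1$. If $D\in SDer^n(A)$, then $D$ is a derivation of order $\le n$ on $A$.
   Context: Let $A$ be a commutative associative algebra with unit $e$ over the field $\mathbb{K}$, product written by juxtaposition. $Der(A)$ is the space of $\mathbb{K}$-linear maps $X:A\to A$ with $X(ab)=X(a)b+aX(b)$. $SDer^n(A)$ is the set of all $\mathbb{K}$-linear maps $A\to A$ that are linear combinations of composites $X_1\circ\cdots\circ X_r$ with $X_1,\dots,X_r\in Der(A)$ and $1\le r\le n$. Differential operators are defined recursively: a map $D:A\to A$ is a differential operator of order $0$ iff there is $a\in A$ with $D(b)=ab$ for all $b\in A$; for $r\ge1$, a $\mathbb{K}$-linear map $D:A\to A$ is a differential operator of order $\le r$ iff for every $a\in A$ the map $b\mapsto D(ab)-aD(b)$ is a differential operator of order $\le r-1$ (where "order $\le 0$" means order $0$). A derivation of order $\le r$ on $A$ is a differential operator $D$ of order $\le r$ such that $D(\alpha e)=0$ for all $\alpha\in\mathbb{K}$. *)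

theory Defs
  imports Complex_Main "HOL-Library.Function_Algebras"
begin

text \<open>
  The unit \<open>e\<close> is a parameter over the class \<open>comm_ring\<close>, since \<open>comm_ring_1\<close>
  would impose \<open>0 \<noteq> 1\<close> and so exclude the zero algebra.
\<close>

locale comm_unital_algebra = vector_space scale
  for scale :: "'k::field \<Rightarrow> 'a::comm_ring \<Rightarrow> 'a" +
  fixes e :: 'a
  assumes unit_mult: "e * a = a"
    and scale_mult: "scale c a * b = scale c (a * b)"

definition Der :: "('k::field \<Rightarrow> 'a::comm_ring \<Rightarrow> 'a) \<Rightarrow> ('a \<Rightarrow> 'a) set" where
  "Der scale = {X. Vector_Spaces.linear scale scale X \<and> (\<forall>a b. X (a * b) = X a * b + a * X b)}"

definition scale_fun :: "('k \<Rightarrow> 'a \<Rightarrow> 'a) \<Rightarrow> 'k \<Rightarrow> ('a \<Rightarrow> 'a) \<Rightarrow> 'a \<Rightarrow> 'a" where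
  "scale_fun scale c D = (\<lambda>a. scale c (D a))"

lemma vector_space_scale_fun:
  assumes "vector_space scale"
  shows "vector_space (scale_fun scale)"
proof -
  interpret vector_space scale by (rule assms)
  show ?thesis
    by unfold_locales (simp_all add: scale_fun_def fun_eq_iff scale_right_distrib scale_left_distrib)
qed

text \<open>The span is taken among all maps \<open>A \<rightarrow> A\<close>, with pointwise addition and \<open>scale_fun\<close>.\<close>

definition SDer :: "('k::field \<Rightarrow> 'a::comm_ring \<Rightarrow> 'a) \<Rightarrow> nat \<Rightarrow> ('a \<Rightarrow> 'a) set" where
  "SDer scale n = module.span (scale_fun scale)
     {foldr (\<circ>) Xs id | Xs. set Xs \<subseteq> Der scale \<and> 1 \<le> length Xs \<and> length Xs \<le> n}"

text \<open>\<open>diff_op scale r D\<close>: the map \<open>D\<close> is a differential operator of order at most \<open>r\<close>.\<close>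

primrec diff_op :: "('k::field \<Rightarrow> 'a::comm_ring \<Rightarrow> 'a) \<Rightarrow> nat \<Rightarrow> ('a \<Rightarrow> 'a) \<Rightarrow> bool" where
  "diff_op scale 0 D \<longleftrightarrow> (\<exists>a. \<forall>b. D b = a * b)"
| "diff_op scale (Suc r) D \<longleftrightarrow>
     Vector_Spaces.linear scale scale D \<and> (\<forall>a. diff_op scale r (\<lambda>b. D (a * b) - a * D b))"

definition derivation_of_order_le ::
    "('k::field \<Rightarrow> 'a::comm_ring \<Rightarrow> 'a) \<Rightarrow> 'a \<Rightarrow> nat \<Rightarrow> ('a \<Rightarrow> 'a) \<Rightarrow> bool" where
  "derivation_of_order_le scale e r D \<longleftrightarrow> diff_op scale r D \<and> (\<forall>\<alpha>. D (scale \<alpha> e) = 0)"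

end

theory Submission
  imports Defs
begin

text \<open>
  Write \<open>[D, a]\<close> for the map \<open>b \<mapsto> D (a * b) - a * D b\<close>.  For a derivation \<open>X\<close> and a linear map
  \<open>D\<close>, the Leibniz rule gives
  \<open>[X \<circ> D, a] = X \<circ> [D, a] + X a \<cdot> D\<close>.
  If \<open>D\<close> has order at most \<open>r\<close>, then \<open>[D, a]\<close> has order at most \<open>r - 1\<close> (and is zero for
  \<open>r = 0\<close>), so by induction \<open>X \<circ> [D, a]\<close> has order at most \<open>r\<close>; since operators of order at most
  \<open>r\<close> form an \<open>A\<close>-module, \<open>X \<circ> D\<close> has order at most \<open>r + 1\<close> (\<open>diff_op_derivation_comp\<close>).
  Starting from the identity, which has order \<open>0\<close>, a composite of \<open>r\<close> derivations therefore has
  order at most \<open>r\<close>.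

  Such a composite with \<open>r \<ge> 1\<close> kills the scalars, since its innermost factor does: \<open>e * e = e\<close>
  forces \<open>X e = X e + X e\<close>.  Finally, the derivations of order at most \<open>n\<close> form a linear
  subspace of the maps \<open>A \<rightarrow> A\<close>, which hence contains the span of the composites.
\<close>

context comm_unital_algebra
begin

lemma mult_scale: "a * scale c b = scale c (a * b)"
  by (metis mult.commute scale_mult)

lemma linear_iff:
  "Vector_Spaces.linear scale scale D \<longleftrightarrow>
     (\<forall>x y. D (x + y) = D x + D y) \<and> (\<forall>c x. D (scale c x) = scale c (D x))"
  by (auto simp: Vector_Spaces.linear_iff vector_space_axioms)

lemma diff_op_linear: "diff_op scale r D \<Longrightarrow> Vector_Spaces.linear scale scale D"
  by (cases r) (auto simp: linear_iff distrib_left mult_scale)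

lemma diff_op_zero: "diff_op scale r (\<lambda>b. 0)"
proof (induction r)
  case 0
  show ?case by (auto intro!: exI[of _ 0])
next
  case (Suc r)
  then show ?case by (simp add: linear_iff)
qed

lemma diff_op_add:
  "diff_op scale r D \<Longrightarrow> diff_op scale r E \<Longrightarrow> diff_op scale r (\<lambda>b. D b + E b)"
proof (induction r arbitrary: D E)
  case 0
  then obtain k m where "\<And>b. D b = k * b" and "\<And>b. E b = m * b"
    by auto
  then have "\<forall>b. D b + E b = (k + m) * b"
    by (simp add: distrib_right)
  then show ?case
    unfolding diff_op.simps by (rule exI)
next
  case (Suc r)
  have "diff_op scale r (\<lambda>b. (D (a * b) - a * D b) + (E (a * b) - a * E b))" for a
    using Suc by simp
  then have "diff_op scale r (\<lambda>b. (D (a * b) + E (a * b)) - a * (D b + E b))" for a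
    by (simp add: distrib_left add_diff_add)
  moreover have "Vector_Spaces.linear scale scale (\<lambda>b. D b + E b)"
    using Suc.prems by (simp add: linear_iff scale_right_distrib add_ac)
  ultimately show ?case
    by simp
qed

lemma diff_op_scale: "diff_op scale r D \<Longrightarrow> diff_op scale r (\<lambda>b. scale c (D b))"
proof (induction r arbitrary: D)
  case 0
  then obtain m where "\<And>b. D b = m * b"
    by auto
  then have "\<forall>b. scale c (D b) = scale c m * b"
    by (simp add: scale_mult)
  then show ?case
    unfolding diff_op.simps by (rule exI)
next
  case (Suc r)
  have "diff_op scale r (\<lambda>b. scale c (D (a * b) - a * D b))" for a
    using Suc by simp
  then have "diff_op scale r (\<lambda>b. scale c (D (a * b)) - a * scale c (D b))" for a
    by (simp add: scale_right_diff_distrib mult_scale)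
  moreover have "Vector_Spaces.linear scale scale (\<lambda>b. scale c (D b))"
    using Suc.prems by (simp add: linear_iff scale_right_distrib scale_left_commute)
  ultimately show ?case
    by simp
qed

lemma diff_op_mult: "diff_op scale r D \<Longrightarrow> diff_op scale r (\<lambda>b. m * D b)"
proof (induction r arbitrary: D)
  case 0
  then obtain k where "\<And>b. D b = k * b"
    by auto
  then have "\<forall>b. m * D b = (m * k) * b"
    by (simp add: mult.assoc)
  then show ?case
    unfolding diff_op.simps by (rule exI)
next
  case (Suc r)
  have "diff_op scale r (\<lambda>b. m * (D (a * b) - a * D b))" for a
    using Suc by simp
  then have "diff_op scale r (\<lambda>b. m * D (a * b) - a * (m * D b))" for a
    by (simp add: right_diff_distrib mult.left_commute)
  moreover have "Vector_Spaces.linear scale scale (\<lambda>b. m * D b)"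
    using Suc.prems by (simp add: linear_iff distrib_left mult_scale)
  ultimately show ?case
    by simp
qed

text \<open>
  Multiplication operators commute with each other, so an operator of order \<open>0\<close> has zero
  commutators; the recursive definition carries the inclusion to higher orders.
\<close>

lemma diff_op_Suc: "diff_op scale r D \<Longrightarrow> diff_op scale (Suc r) D"
proof (induction r arbitrary: D)
  case 0
  then obtain m where "\<And>b. D b = m * b" by auto
  then have "(\<lambda>b. D (a * b) - a * D b) = (\<lambda>b. 0)" for a
    by (simp add: mult.left_commute)
  moreover have "Vector_Spaces.linear scale scale D"
    using "0" by (rule diff_op_linear)
  ultimately show ?case
    using diff_op_zero[of 0] by simp
next
  case (Suc r)
  then have "Vector_Spaces.linear scale scale D"
    and "diff_op scale r (\<lambda>b. D (a * b) - a * D b)" for a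
    by simp_all
  then show ?case
    using Suc.IH diff_op.simps(2) by blast
qed

lemma diff_op_mono:
  assumes "r \<le> s" and "diff_op scale r D"
  shows "diff_op scale s D"
  using assms
proof (induction s rule: dec_induct)
  case (step s)
  show ?case
    by (rule diff_op_Suc) (rule step.IH[OF step.prems])
qed

lemma Der_linear: "X \<in> Der scale \<Longrightarrow> Vector_Spaces.linear scale scale X"
  by (simp add: Der_def)

lemma Der_zero:
  assumes "X \<in> Der scale"
  shows "X 0 = 0"
proof -
  have "X (0 + 0) = X 0 + X 0"
    using Der_linear[OF assms] unfolding linear_iff by blast
  then show ?thesis by simp
qed

lemma Der_scalar:
  assumes "X \<in> Der scale"
  shows "X (scale c e) = 0"
proof -
  have "X (e * e) = X e * e + e * X e"
    using assms unfolding Der_def by blast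
  also have "\<dots> = X e + X e"
    by (simp add: mult.commute[of "X e"] unit_mult)
  finally have "X e = 0"
    by (simp add: unit_mult)
  then show ?thesis
    using Der_linear[OF assms] by (simp add: linear_iff)
qed

text \<open>
  The Leibniz rule moves \<open>a\<close> past \<open>X \<circ> D\<close> at the cost of \<open>X \<circ> [D, a] + X a \<cdot> D\<close>.  The second
  summand is a multiple of \<open>D\<close>.  In the first, \<open>[D, a]\<close> vanishes for \<open>r = 0\<close> and otherwise has
  order at most \<open>r - 1\<close>, so that induction applies.  Both summands thus have order at most \<open>r\<close>.
\<close>

lemma diff_op_derivation_comp:
  assumes X: "X \<in> Der scale"
    and D: "diff_op scale r D"
  shows "diff_op scale (Suc r) (X \<circ> D)"
proof -
  have add: "X (x + y) = X x + X y" and leibniz: "X (x * y) = X x * y + x * X y" for x y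
    using X by (auto simp: Der_def linear_iff)
  have lin: "Vector_Spaces.linear scale scale (X \<circ> D)" if "diff_op scale r D" for r D
    using Der_linear[OF X] diff_op_linear[OF that] by (simp add: linear_iff)
  have comm: "(X \<circ> D) (a * b) - a * (X \<circ> D) b = X (D (a * b) - a * D b) + X a * D b"
    for D a b
  proof -
    have "X (D (a * b)) = X ((D (a * b) - a * D b) + a * D b)"
      by simp
    also have "\<dots> = X (D (a * b) - a * D b) + (X a * D b + a * X (D b))"
      by (simp only: add leibniz)
    finally show ?thesis
      by simp
  qed
  show ?thesis
    using D
  proof (induction r arbitrary: D)
    case 0
    then obtain m where "\<And>b. D b = m * b"
      by auto
    then have "D (a * b) - a * D b = 0" for a b
      by (simp add: mult.left_commute)
    then have "(\<lambda>b. (X \<circ> D) (a * b) - a * (X \<circ> D) b) = (\<lambda>b. X a * D b)" for a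
      unfolding comm by (simp add: Der_zero[OF X])
    moreover have "diff_op scale 0 (\<lambda>b. X a * D b)" for a
      using "0" by (rule diff_op_mult)
    ultimately show ?case
      using lin[OF "0"] by (simp only: diff_op.simps(2) simp_thms)
  next
    case (Suc r)
    have "diff_op scale (Suc r) (X \<circ> (\<lambda>b. D (a * b) - a * D b))" for a
      using Suc.prems by (intro Suc.IH) simp
    then have "diff_op scale (Suc r) (\<lambda>b. X (D (a * b) - a * D b) + X a * D b)" for a
      using diff_op_add diff_op_mult[OF Suc.prems] unfolding comp_def by blast
    then have "diff_op scale (Suc r) (\<lambda>b. (X \<circ> D) (a * b) - a * (X \<circ> D) b)" for a
      unfolding comm .
    then show ?case
      using lin[OF Suc.prems] diff_op.simps(2) by blast
  qed
qed

lemma diff_op_derivations_comp: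
  "set Xs \<subseteq> Der scale \<Longrightarrow> diff_op scale (length Xs) (foldr (\<circ>) Xs id)"
proof (induction Xs)
  case Nil
  have "\<forall>b. id b = e * b"
    by (simp add: unit_mult)
  then show ?case
    unfolding list.size foldr.simps id_apply diff_op.simps by (rule exI)
next
  case (Cons X Xs)
  have "X \<in> Der scale" and "set Xs \<subseteq> Der scale"
    using Cons.prems by auto
  then have "diff_op scale (Suc (length Xs)) (X \<circ> foldr (\<circ>) Xs id)"
    using Cons.IH diff_op_derivation_comp by blast
  then show ?case
    unfolding foldr.simps comp_apply length_Cons .
qed

lemma derivations_comp_scalar:
  "set Xs \<subseteq> Der scale \<Longrightarrow> Xs \<noteq> [] \<Longrightarrow> foldr (\<circ>) Xs id (scale c e) = 0"
proof (induction Xs)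
  case (Cons X Xs)
  then show ?case
    by (cases "Xs = []") (simp_all add: Der_zero Der_scalar)
qed simp

lemma derivation_of_order_le_subspace:
  "module.subspace (scale_fun scale) {D. derivation_of_order_le scale e n D}"
proof -
  interpret maps: vector_space "scale_fun scale"
    by (rule vector_space_scale_fun) (rule vector_space_axioms)
  show ?thesis
    by (rule maps.subspaceI)
      (simp_all add: derivation_of_order_le_def diff_op_zero diff_op_add diff_op_scale
         scale_fun_def zero_fun_def plus_fun_def)
qed

lemma SDer_derivation_of_order_le:
  "SDer scale n \<subseteq> {D. derivation_of_order_le scale e n D}"
proof -
  interpret maps: vector_space "scale_fun scale"
    by (rule vector_space_scale_fun) (rule vector_space_axioms)
  have "derivation_of_order_le scale e n (foldr (\<circ>) Xs id)"
    if "set Xs \<subseteq> Der scale" "1 \<le> length Xs" "length Xs \<le> n" for Xs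
  proof -
    have "diff_op scale n (foldr (\<circ>) Xs id)"
      using diff_op_mono[OF that(3) diff_op_derivations_comp[OF that(1)]] .
    moreover have "foldr (\<circ>) Xs id (scale c e) = 0" for c
      using that(1,2) by (intro derivations_comp_scalar) auto
    ultimately show ?thesis
      by (simp add: derivation_of_order_le_def)
  qed
  then show ?thesis
    unfolding SDer_def by (intro maps.span_minimal derivation_of_order_le_subspace) auto
qed

end

theorem theorem4p1:
  fixes scale :: "'k::field \<Rightarrow> 'a::comm_ring \<Rightarrow> 'a"
    and e :: 'a and n :: nat and D :: "'a \<Rightarrow> 'a"
  assumes "comm_unital_algebra scale e"
    and "n \<ge> 1"
    and "D \<in> SDer scale n"
  shows "derivation_of_order_le scale e n D"
  using comm_unital_algebra.SDer_derivation_of_order_le[OF assms(1)] assms(3) by auto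

end
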